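(* Let $\gamma,\alpha\in(0,1)$ and consider testing $H_1,\ldots,H_s$ with p-values $\hat p_1,\ldots,\hat p_s$. Let $\hat q_1,\ldots,\hat q_{|I|}$ denote the p-values corresponding to the $|I|=|I(P)|$ true null hypotheses and $\hat r_1,\ldots,\hat r_{s-|I|}$ the p-values of the false null hypotheses. Assume that for any $i=1,\ldots,|I|$ (and every $u\in(0,1)$), $$P\{\hat q_i\le u\mid \hat r_1,\ldots,\hat r_{s-|I|}\}\le u .$$ Then the stepdown procedure with constants $$\alpha_i=\frac{(\lfloor\gamma i\rfloor+1)\alpha}{s+\lfloor\gamma i\rfloor+1-i},\qquad i=1,\ldots,s,$$ controls the false discovery proportion in the sense that $$P\{FDP>\gamma\}\le\alpha .$$
   Context: Data $X$ is available from some model $P\in\Omega$. A hypothesis $H_i$ is identified with a subset $\omega_i\subset\Omega$ and asserts $P\in\omega_i$. $I=I(P)=\{i: P\in\omega_i\}$ is the set of indices of true null hypotheses under the true distribution $P$. The p-values are $[0,1]$-valued statistics (functions of $X$). Let $\hat p_{(1)}\le\cdots\le\hat p_{(s)}$ be the ordered p-values and $H_{(1)},\ldots,H_{(s)}$ the associated hypotheses (ties ordered arbitrarily). Given constants $\alpha_1\le\alpha_2\le\cdots\le\alpha_s$, the stepdown procedure with these constants is: if $\hat p_{(1)}>\alpha_1$, reject no hypotheses; otherwise reject $H_{(1)},\ldots,H_{(r)}$, where $r$ is the largest index such that $\hat p_{(1)}\le\alpha_1,\ldots,\hat p_{(r)}\le\alpha_r$. The false discovery proportion $FDP$ is the number of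 false rejections (rejected $H_i$ with $i\in I(P)$) divided by the total number of rejections, and is defined to be $0$ if there are no rejections. $\lfloor x\rfloor$ is the greatest integer $\le x$. *)

theory Defs
  imports "HOL-Probability.Probability"
begin

text \<open>
  The data \<open>X\<close> are modelled canonically: the sample space is a measurable space
  \<open>M\<close>, a model is a set of probability measures on \<open>M\<close> (the possible laws of
  \<open>X\<close>), and statistics are measurable functions on \<open>M\<close>. Hypotheses are indexed
  by \<open>{1..s}\<close>.
\<close>

definition true_nulls :: "nat \<Rightarrow> (nat \<Rightarrow> 'x measure set) \<Rightarrow> 'x measure \<Rightarrow> nat set" where
  "true_nulls s \<omega> P = {i \<in> {1..s}. P \<in> \<omega> i}"

definition sigma_generated ::
    "'x measure \<Rightarrow> nat set \<Rightarrow> (nat \<Rightarrow> 'x \<Rightarrow> real) \<Rightarrow> 'x measure" where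
  "sigma_generated P J Y =
     vimage_algebra (space P) (\<lambda>x. \<lambda>j\<in>J. Y j x) (\<Pi>\<^sub>M j\<in>J. borel)"

text \<open>Conditional probability of an event given a sub-sigma-algebra, determined up to null sets;
  the library's \<open>cond_prob\<close> only conditions on an event.\<close>

definition cond_prob_given :: "'x measure \<Rightarrow> 'x measure \<Rightarrow> 'x set \<Rightarrow> 'x \<Rightarrow> real" where
  "cond_prob_given P F A = real_cond_exp P F (indicator A)"

text \<open>\<open>\<pi> k\<close> is the index of the hypothesis with the \<open>k\<close>-th smallest p-value. If there are ties,
  several \<open>\<pi>\<close> qualify.\<close>

definition orders_pvalues :: "nat \<Rightarrow> (nat \<Rightarrow> real) \<Rightarrow> (nat \<Rightarrow> nat) \<Rightarrow> bool" where
  "orders_pvalues s p \<pi> \<longleftrightarrow>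
     bij_betw \<pi> {1..s} {1..s} \<and> (\<forall>j\<in>{1..s}. \<forall>k\<in>{1..s}. j \<le> k \<longrightarrow> p (\<pi> j) \<le> p (\<pi> k))"

text \<open>The maximum is \<open>0\<close> exactly when the smallest p-value already exceeds \<open>c 1\<close>
  (or \<open>s = 0\<close>); then nothing is rejected.\<close>

definition stepdown_count ::
    "nat \<Rightarrow> (nat \<Rightarrow> real) \<Rightarrow> (nat \<Rightarrow> real) \<Rightarrow> (nat \<Rightarrow> nat) \<Rightarrow> nat" where
  "stepdown_count s c p \<pi> = Max {r \<in> {0..s}. \<forall>j\<in>{1..r}. p (\<pi> j) \<le> c j}"

definition stepdown_rejections ::
    "nat \<Rightarrow> (nat \<Rightarrow> real) \<Rightarrow> (nat \<Rightarrow> real) \<Rightarrow> (nat \<Rightarrow> nat) \<Rightarrow> nat set" where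
  "stepdown_rejections s c p \<pi> = \<pi> ` {1..stepdown_count s c p \<pi>}"

definition FDP :: "nat set \<Rightarrow> nat set \<Rightarrow> real" where
  "FDP I R = (if R = {} then 0 else real (card (R \<inter> I)) / real (card R))"

definition fdp_constant :: "real \<Rightarrow> real \<Rightarrow> nat \<Rightarrow> nat \<Rightarrow> real" where
  "fdp_constant \<gamma> \<alpha> s i =
     (real_of_int \<lfloor>\<gamma> * real i\<rfloor> + 1) * \<alpha> /
     (real s + real_of_int \<lfloor>\<gamma> * real i\<rfloor> + 1 - real i)"

end

theory Submission
  imports Defs
begin

text \<open>
  Write \<open>c j\<close> for the constants, \<open>m j = \<lfloor>\<gamma> j\<rfloor> + 1\<close> for the smallest number of true nulls which
  among \<open>j\<close> rejections makes the false discovery proportion exceed \<open>\<gamma>\<close>, and let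
  \<open>A\<close> be the set of false nulls. The difficulty is that the number of rejections depends on all
  p-values, while the hypothesis only controls a true null p-value given those of the false nulls.
  It is overcome by an index \<open>J\<close> that is a function of the latter alone: the first \<open>j\<close> such
  that at most \<open>j - m j\<close> false nulls have a p-value \<open>\<le> c j\<close>.

  Suppose that \<open>R\<close> hypotheses are rejected and that the proportion exceeds \<open>\<gamma>\<close>. The
  hypotheses with p-value \<open>\<le> c R\<close> are exactly the rejected ones, and at least \<open>m R\<close> of them are
  true nulls, so \<open>R\<close> meets the condition defining \<open>J\<close>; hence \<open>J \<le> R\<close>. As step \<open>J\<close> is passed,
  at least \<open>J\<close> p-values are \<open>\<le> c J\<close>, and at most \<open>J - m J\<close> of these belong to false
  nulls. Thus at least \<open>m J\<close> true nulls have a p-value \<open>\<le> c J\<close> (\<open>fdp_exceedance_pivot\<close>).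

  Given the p-values of the false nulls, Markov's inequality bounds the probability of
  this by \<open>card I * c J / m J\<close>, where \<open>I\<close> is the set of true nulls. Minimality of \<open>J\<close>
  forces \<open>J - m J \<le> card A\<close>, that is, \<open>card I \<le> s + m J - J\<close>, and the constants are chosen
  such that the bound is then at most \<open>\<alpha>\<close> (\<open>fdp_constant_pivot_le\<close>). Summing over the
  disjoint events \<open>J = j\<close> gives the theorem.
\<close>

section \<open>Averaging a conditional bound and counting events\<close>

text \<open>A bound on the conditional probability averages over any event \<open>D\<close> that the conditioning
  \<open>\<sigma>\<close>-algebra decides. This is the only way in which the dependence assumption on the p-values
  enters.\<close>

lemma (in prob_space) prob_Int_le_if_cond_prob_given_le:
  assumes F: "subalgebra M F" and D: "D \<in> sets F" and A: "A \<in> sets M"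
    and le: "AE x in M. cond_prob_given M F A x \<le> u"
  shows "prob (D \<inter> A) \<le> u * prob D"
proof -
  interpret finite_measure_subalgebra M F
    by unfold_locales (rule F)
  have DM: "D \<in> sets M"
    using D F by (auto simp: subalgebra_def)
  let ?f = "indicator A :: 'a \<Rightarrow> real"
  have int: "integrable M ?f"
    using A by (intro integrable_real_indicator) (auto simp: emeasure_eq_measure)
  have int2: "integrable M (real_cond_exp M F ?f)"
    using int by (rule real_cond_exp_int)
  have "prob (D \<inter> A) = (\<integral>x\<in>D. ?f x \<partial>M)"
  proof -
    have "(\<integral>x\<in>D. ?f x \<partial>M) = (\<integral>x. indicator (D \<inter> A) x \<partial>M)"
      unfolding set_lebesgue_integral_def
      by (intro Bochner_Integration.integral_cong) (auto simp: indicator_def)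
    then show ?thesis
      using A DM by simp
  qed
  also have "\<dots> = (\<integral>x\<in>D. real_cond_exp M F ?f x \<partial>M)"
    using int D by (rule real_cond_exp_intA)
  also have "\<dots> \<le> (\<integral>x\<in>D. u \<partial>M)"
    unfolding set_lebesgue_integral_def
  proof (rule integral_mono_AE)
    show "integrable M (\<lambda>x. indicator D x *\<^sub>R real_cond_exp M F ?f x)"
      using DM int2 by (rule integrable_mult_indicator)
    show "integrable M (\<lambda>x. indicator D x *\<^sub>R u)"
      using DM by (intro integrable_mult_indicator) auto
    show "AE x in M. indicator D x *\<^sub>R real_cond_exp M F ?f x \<le> indicator D x *\<^sub>R u"
      using le by eventually_elim (auto simp: cond_prob_given_def indicator_def)
  qed
  also have "\<dots> = u * prob D"
    using DM by (simp add: set_lebesgue_integral_def)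
  finally show ?thesis .
qed

lemma borel_measurable_real_card_le:
  fixes p :: "'i \<Rightarrow> 'x \<Rightarrow> real"
  assumes "finite A" and p: "\<And>i. i \<in> A \<Longrightarrow> p i \<in> borel_measurable N"
  shows "(\<lambda>x. real (card {i \<in> A. p i x \<le> t})) \<in> borel_measurable N"
proof -
  have "(\<lambda>x. real (card {i \<in> A. p i x \<le> t})) = (\<lambda>x. \<Sum>i\<in>A. if p i x \<le> t then 1 else 0)"
    using \<open>finite A\<close> by (simp flip: sum.inter_filter)
  moreover have "\<dots> \<in> borel_measurable N"
    using p by (intro borel_measurable_sum measurable_If) auto
  ultimately show ?thesis
    by simp
qed

text \<open>Markov's inequality for the number of indices whose p-value is at most \<open>t\<close>.\<close>

lemma (in finite_measure) measure_card_le_sum_measure: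
  fixes p :: "'i \<Rightarrow> 'a \<Rightarrow> real"
  assumes "finite I" and D: "D \<in> sets M" and p: "\<And>i. i \<in> I \<Longrightarrow> p i \<in> borel_measurable M"
  shows "real m * measure M {x \<in> D. m \<le> card {i \<in> I. p i x \<le> t}}
           \<le> (\<Sum>i\<in>I. measure M (D \<inter> {x \<in> space M. p i x \<le> t}))"
proof -
  let ?E = "{x \<in> D. m \<le> card {i \<in> I. p i x \<le> t}}"
  let ?A = "\<lambda>i. D \<inter> {x \<in> space M. p i x \<le> t}"
  have sub: "D \<subseteq> space M"
    using D by (rule sets.sets_into_space)
  have "?E = D \<inter> {x \<in> space M. real m \<le> real (card {i \<in> I. p i x \<le> t})}"
    using sub by auto
  moreover have "{x \<in> space M. real m \<le> real (card {i \<in> I. p i x \<le> t})} \<in> sets M"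
    using borel_measurable_real_card_le[OF \<open>finite I\<close> p] by (intro borel_measurable_le) auto
  ultimately have E: "?E \<in> sets M"
    using D by auto
  have A: "?A i \<in> sets M" if "i \<in> I" for i
    using p[OF that] D by (intro sets.Int borel_measurable_le) auto
  have "real m * measure M ?E = (\<integral>x. real m * indicator ?E x \<partial>M)"
    using E by simp
  also have "\<dots> \<le> (\<integral>x. (\<Sum>i\<in>I. indicator (?A i) x) \<partial>M)"
  proof (rule integral_mono)
    show "integrable M (\<lambda>x. real m * indicator ?E x)"
      using E by (auto simp: emeasure_eq_measure)
    show "integrable M (\<lambda>x. \<Sum>i\<in>I. indicator (?A i) x :: real)"
      using A by (intro Bochner_Integration.integrable_sum integrable_real_indicator)
        (auto simp: emeasure_eq_measure)
    fix x
    have "(\<Sum>i\<in>I. indicator (?A i) x :: real) = real (card {i \<in> I. p i x \<le> t})"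
      if "x \<in> D"
    proof -
      have "(\<Sum>i\<in>I. indicator (?A i) x :: real) = (\<Sum>i\<in>I. if p i x \<le> t then 1 else 0)"
        using that sub by (intro sum.cong) (auto simp: indicator_def)
      then show ?thesis
        using \<open>finite I\<close> by (simp flip: sum.inter_filter)
    qed
    then show "real m * indicator ?E x \<le> (\<Sum>i\<in>I. indicator (?A i) x)"
      by (auto simp: indicator_def intro!: sum_nonneg)
  qed
  also have "\<dots> = (\<Sum>i\<in>I. measure M (?A i))"
    using A by (subst Bochner_Integration.integral_sum) (auto simp: emeasure_eq_measure)
  finally show ?thesis .
qed

lemma subalgebra_sigma_generated:
  assumes "\<And>j. j \<in> J \<Longrightarrow> Y j \<in> borel_measurable P"
  shows "subalgebra P (sigma_generated P J Y)"
proof -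
  have "(\<lambda>x. \<lambda>j\<in>J. Y j x) \<in> P \<rightarrow>\<^sub>M (\<Pi>\<^sub>M j\<in>J. borel)"
    using assms by (intro measurable_restrict) auto
  then show ?thesis
    unfolding subalgebra_def sigma_generated_def
    by (auto simp: measurable_def sets_vimage_algebra2)
qed

lemma measurable_sigma_generated:
  assumes "j \<in> J"
  shows "Y j \<in> borel_measurable (sigma_generated P J Y)"
proof -
  have "(\<lambda>x. \<lambda>j\<in>J. Y j x) \<in> sigma_generated P J Y \<rightarrow>\<^sub>M (\<Pi>\<^sub>M j\<in>J. borel)"
    unfolding sigma_generated_def by (rule measurable_vimage_algebra1) (auto simp: space_PiM)
  from measurable_compose[OF this measurable_component_singleton[OF assms]]
  have "(\<lambda>x. (\<lambda>j\<in>J. Y j x) j) \<in> borel_measurable (sigma_generated P J Y)" .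
  then show ?thesis
    using assms by simp
qed

section \<open>The critical number of true rejections and the stepdown constants\<close>

text \<open>The least number of true nulls among \<open>j\<close> rejections for which the false discovery proportion
  exceeds \<open>\<gamma>\<close>.\<close>

definition critical_count :: "real \<Rightarrow> nat \<Rightarrow> nat" where
  "critical_count \<gamma> j = nat \<lfloor>\<gamma> * real j\<rfloor> + 1"

lemma critical_count_le_iff:
  assumes "0 < \<gamma>"
  shows "critical_count \<gamma> j \<le> n \<longleftrightarrow> \<gamma> * real j < real n"
proof -
  have "0 \<le> \<gamma> * real j"
    using assms by simp
  then show ?thesis
    unfolding critical_count_def by linarith
qed

lemma critical_count_le:
  assumes "0 < \<gamma>" "\<gamma> < 1" "1 \<le> j"
  shows "critical_count \<gamma> j \<le> j"
  using assms by (simp add: critical_count_le_iff)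

lemma critical_count_mono:
  assumes "0 < \<gamma>" "i \<le> j"
  shows "critical_count \<gamma> i \<le> critical_count \<gamma> j"
  unfolding critical_count_def using assms by (intro add_mono nat_mono floor_mono) auto

lemma fdp_constant_critical_count:
  assumes "0 < \<gamma>"
  shows "fdp_constant \<gamma> \<alpha> s j =
    real (critical_count \<gamma> j) * \<alpha> / (real s + real (critical_count \<gamma> j) - real j)"
proof -
  have "0 \<le> \<gamma> * real j"
    using assms by simp
  then show ?thesis
    unfolding fdp_constant_def critical_count_def by (simp add: algebra_simps)
qed

text \<open>The constants have the form \<open>\<alpha> * m / (a + m)\<close>, where \<open>a = s - j\<close> decreases and the critical
  count \<open>m\<close> increases with \<open>j\<close>.\<close>

lemma fdp_constant_mono:
  assumes "0 < \<gamma>" "0 < \<alpha>" "i \<le> j" "j \<le> s"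
  shows "fdp_constant \<gamma> \<alpha> s i \<le> fdp_constant \<gamma> \<alpha> s j"
proof -
  let ?a = "real (critical_count \<gamma> i)" and ?b = "real (critical_count \<gamma> j)"
  have pos: "0 < ?a" "0 < ?b"
    by (auto simp: critical_count_def)
  have "?a * (real s - real j) \<le> ?b * (real s - real i)"
    using assms critical_count_mono[of \<gamma> i j] by (intro mult_mono) auto
  then have "?a * (real s + ?b - real j) \<le> ?b * (real s + ?a - real i)"
    by (simp add: algebra_simps)
  then have "\<alpha> * (?a * (real s + ?b - real j)) \<le> \<alpha> * (?b * (real s + ?a - real i))"
    using assms by (intro mult_left_mono) auto
  then show ?thesis
    using assms pos by (simp add: fdp_constant_critical_count divide_simps mult_ac)
qed

lemma fdp_constant_bounds:
  assumes "0 < \<gamma>" "0 < \<alpha>" "\<alpha> < 1" "j \<le> s"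
  shows "0 < fdp_constant \<gamma> \<alpha> s j" "fdp_constant \<gamma> \<alpha> s j < 1"
proof -
  let ?a = "real (critical_count \<gamma> j)"
  have pos: "0 < ?a"
    by (auto simp: critical_count_def)
  then show "0 < fdp_constant \<gamma> \<alpha> s j"
    using assms by (simp add: fdp_constant_critical_count)
  have "?a * \<alpha> < ?a"
    using pos assms by simp
  also have "\<dots> \<le> real s + ?a - real j"
    using assms by simp
  finally show "fdp_constant \<gamma> \<alpha> s j < 1"
    using assms pos by (simp add: fdp_constant_critical_count)
qed

section \<open>A pivotal step determined by the false nulls\<close>

text \<open>When the procedure passes step \<open>j\<close>, at least \<open>j\<close> p-values are \<open>\<le> c j\<close>. If at most
  \<open>j - critical_count \<gamma> j\<close> of them belong to \<open>A\<close>, then at least \<open>critical_count \<gamma> j\<close> do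
  not. The pivot is the first step at which the p-values in \<open>A\<close> alone force this conclusion.\<close>

definition pivot_step :: "real \<Rightarrow> (nat \<Rightarrow> real) \<Rightarrow> nat set \<Rightarrow> (nat \<Rightarrow> real) \<Rightarrow> nat \<Rightarrow> bool" where
  "pivot_step \<gamma> c A p j \<longleftrightarrow>
     card {i \<in> A. p i \<le> c j} \<le> j - critical_count \<gamma> j \<and>
     (\<forall>l\<in>{1..<j}. l - critical_count \<gamma> l < card {i \<in> A. p i \<le> c l})"

lemma pivot_step_unique:
  assumes "pivot_step \<gamma> c A p i" "pivot_step \<gamma> c A p j" "1 \<le> i" "1 \<le> j"
  shows "i = j"
proof (rule ccontr)
  assume "i \<noteq> j"
  then consider "i \<in> {1..<j}" | "j \<in> {1..<i}"
    using assms(3,4) by fastforce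
  then show False
    using assms(1,2) unfolding pivot_step_def by cases (meson not_le)+
qed

text \<open>The slack \<open>j - critical_count \<gamma> j\<close> grows by at most one per step. Since the
  step before the pivot has more hypotheses of \<open>A\<close> below its constant than its slack, the slack at
  the pivot is at most the number of these hypotheses.\<close>

lemma pivot_step_le_card:
  assumes "0 < \<gamma>" "finite A" "pivot_step \<gamma> c A p j" "1 \<le> j"
  shows "j - critical_count \<gamma> j \<le> card A"
proof (cases "j = 1")
  case True
  then show ?thesis
    by (simp add: critical_count_def)
next
  case False
  have "j - critical_count \<gamma> j \<le> Suc (j - 1 - critical_count \<gamma> (j - 1))"
    using critical_count_mono[OF assms(1), of "j - 1" j] by linarith
  also have "\<dots> \<le> card {i \<in> A. p i \<le> c (j - 1)}"
    using assms(3,4) False unfolding pivot_step_def Suc_le_eq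
    by (elim conjE bspec) auto
  also have "\<dots> \<le> card A"
    using assms(2) by (intro card_mono) auto
  finally show ?thesis .
qed

text \<open>The denominator \<open>s + m - j\<close> of the constant, where \<open>m\<close> is the critical count, is the largest
  number of true nulls that is compatible with at least \<open>j - m\<close> false ones; by the preceding lemma
  this many exist if \<open>j\<close> is a pivot.\<close>

lemma fdp_constant_pivot_le:
  assumes "0 < \<gamma>" "\<gamma> < 1" "0 < \<alpha>" "I \<subseteq> {1..s}" "j \<in> {1..s}"
    and "pivot_step \<gamma> c ({1..s} - I) p j"
  shows "real (card I) * fdp_constant \<gamma> \<alpha> s j \<le> \<alpha> * real (critical_count \<gamma> j)"
proof -
  let ?m = "critical_count \<gamma> j"
  have m: "?m \<le> j" "0 < ?m"
    using assms critical_count_le[of \<gamma> j] by (auto simp: critical_count_def)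
  have "j - ?m \<le> card ({1..s} - I)"
    using assms by (intro pivot_step_le_card) auto
  moreover have "card ({1..s} - I) + card I = s"
    using assms(4) card_mono[of "{1..s}" I] by (simp add: card_Diff_subset finite_subset)
  ultimately have "real (card I) \<le> real s + real ?m - real j"
    using m by linarith
  then have "(real ?m * \<alpha>) * real (card I) \<le> (real ?m * \<alpha>) * (real s + real ?m - real j)"
    using assms m by (intro mult_left_mono) auto
  then show ?thesis
    using assms m by (simp add: fdp_constant_critical_count divide_simps mult_ac)
qed

lemma stepdown_count_props:
  shows "stepdown_count s c p \<pi> \<le> s"
    and "j \<in> {1..stepdown_count s c p \<pi>} \<Longrightarrow> p (\<pi> j) \<le> c j"
    and "stepdown_count s c p \<pi> < s \<Longrightarrow>
      c (Suc (stepdown_count s c p \<pi>)) < p (\<pi> (Suc (stepdown_count s c p \<pi>)))"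
proof -
  let ?S = "{r \<in> {0..s}. \<forall>j\<in>{1..r}. p (\<pi> j) \<le> c j}"
  let ?R = "stepdown_count s c p \<pi>"
  have R: "?R = Max ?S"
    by (simp add: stepdown_count_def)
  have fin: "finite ?S"
    by simp
  have "?R \<in> ?S"
    unfolding R by (intro Max_in fin) force
  then show "?R \<le> s" and pass: "j \<in> {1..?R} \<Longrightarrow> p (\<pi> j) \<le> c j" for j
    by auto
  assume "?R < s"
  have "Suc ?R \<notin> ?S"
    using Max_ge[OF fin, of "Suc ?R"] unfolding R[symmetric] by linarith
  then have "\<not> (\<forall>j\<in>{1..Suc ?R}. p (\<pi> j) \<le> c j)"
    using \<open>?R < s\<close> by simp
  then obtain j where j: "j \<in> {1..Suc ?R}" "c j < p (\<pi> j)"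
    by (meson not_le)
  then have "j \<notin> {1..?R}"
    using pass[of j] by linarith
  with j(1) have "j = Suc ?R"
    by simp
  with j(2) show "c (Suc ?R) < p (\<pi> (Suc ?R))"
    by simp
qed

lemma card_stepdown_prefix:
  assumes ord: "orders_pvalues s p \<pi>" and "j \<le> s"
  shows "card (\<pi> ` {1..j}) = j" "\<pi> ` {1..j} \<subseteq> {1..s}"
proof -
  have "inj_on \<pi> {1..s}" "\<pi> ` {1..s} = {1..s}"
    using ord by (auto simp: orders_pvalues_def bij_betw_def)
  moreover have sub: "{1..j} \<subseteq> {1..s}"
    using \<open>j \<le> s\<close> by auto
  ultimately show "\<pi> ` {1..j} \<subseteq> {1..s}"
    by blast
  have "inj_on \<pi> {1..j}"
    using \<open>inj_on \<pi> {1..s}\<close> sub by (rule inj_on_subset)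
  then show "card (\<pi> ` {1..j}) = j"
    by (simp add: card_image)
qed

text \<open>Monotonicity of the constants is what excludes hypotheses beyond the last rejected one: the
  first p-value that fails its own constant fails all earlier ones, and so do the larger p-values.\<close>

lemma le_last_constant_imp_rejected:
  assumes ord: "orders_pvalues s p \<pi>"
    and mono: "\<And>i j. i \<le> j \<Longrightarrow> j \<le> s \<Longrightarrow> c i \<le> c j"
    and i: "i \<in> {1..s}" "p i \<le> c (stepdown_count s c p \<pi>)"
  shows "i \<in> stepdown_rejections s c p \<pi>"
proof (rule ccontr)
  let ?R = "stepdown_count s c p \<pi>"
  assume not: "i \<notin> stepdown_rejections s c p \<pi>"
  have "i \<in> \<pi> ` {1..s}"
    using ord i(1) by (simp add: orders_pvalues_def bij_betw_def)
  then obtain l where l: "l \<in> {1..s}" "i = \<pi> l"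
    by blast
  with not have "l \<notin> {1..?R}"
    unfolding stepdown_rejections_def by blast
  with l(1) have "?R < l"
    by simp
  then have "p (\<pi> (Suc ?R)) \<le> p (\<pi> l)"
    using ord l(1) by (auto simp: orders_pvalues_def)
  moreover have "c ?R \<le> c (Suc ?R)"
    using \<open>?R < l\<close> l(1) by (intro mono) auto
  moreover have "c (Suc ?R) < p (\<pi> (Suc ?R))"
    using \<open>?R < l\<close> l(1) by (intro stepdown_count_props(3)) auto
  ultimately show False
    using i(2) l(2) by simp
qed

text \<open>The last step reached by the procedure has the property whose first occurrence is the pivot,
  so the pivot exists and is passed. Passing it means that \<open>j\<close> p-values lie below \<open>c j\<close>,
  while the false nulls supply too few of them.\<close>

lemma fdp_exceedance_pivot:
  assumes \<gamma>: "0 < \<gamma>" "\<gamma> < 1" and I: "I \<subseteq> {1..s}"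
    and ord: "orders_pvalues s p \<pi>"
    and mono: "\<And>i j. i \<le> j \<Longrightarrow> j \<le> s \<Longrightarrow> c i \<le> c j"
    and exceed: "\<gamma> < FDP I (stepdown_rejections s c p \<pi>)"
  shows "\<exists>j\<in>{1..s}. pivot_step \<gamma> c ({1..s} - I) p j \<and>
           critical_count \<gamma> j \<le> card {i \<in> I. p i \<le> c j}"
proof -
  let ?R = "stepdown_count s c p \<pi>" and ?rej = "stepdown_rejections s c p \<pi>"
  let ?A = "{1..s} - I"
  let ?few = "\<lambda>j. 1 \<le> j \<and> card {i \<in> ?A. p i \<le> c j} \<le> j - critical_count \<gamma> j"
  have Rs: "?R \<le> s"
    by (rule stepdown_count_props)
  have finI: "finite I"
    using I by (rule finite_subset) simp
  have rej: "card ?rej = ?R" "?rej \<subseteq> {1..s}" "finite ?rej"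
    using card_stepdown_prefix[OF ord Rs] by (auto simp: stepdown_rejections_def)
  have ne: "?rej \<noteq> {}"
    using exceed \<gamma> by (auto simp: FDP_def)
  then have R1: "1 \<le> ?R"
    using rej(1,3) by (metis One_nat_def Suc_leI card_gt_0_iff)
  have "\<gamma> * real ?R < real (card (?rej \<inter> I))"
    using exceed ne rej(1) R1 by (simp add: FDP_def field_simps)
  then have crit: "critical_count \<gamma> ?R \<le> card (?rej \<inter> I)"
    using \<gamma> by (simp add: critical_count_le_iff)
  have "card {i \<in> ?A. p i \<le> c ?R} \<le> card (?rej - I)"
    using le_last_constant_imp_rejected[OF ord mono] rej(3) by (intro card_mono) auto
  also have "\<dots> = ?R - card (?rej \<inter> I)"
    using rej by (simp add: card_Diff_subset_Int)
  finally have "?few ?R"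
    using crit R1 by linarith
  define j where "j = (LEAST j. ?few j)"
  have few: "?few j" and jR: "j \<le> ?R"
    unfolding j_def using \<open>?few ?R\<close> by (rule LeastI, rule Least_le)
  have js: "j \<in> {1..s}"
    using few jR Rs by auto
  have "\<not> ?few l" if "l < j" for l
    using that unfolding j_def by (rule not_less_Least)
  then have pivot: "pivot_step \<gamma> c ?A p j"
    using few unfolding pivot_step_def by (meson atLeastLessThan_iff not_le)
  have "p (\<pi> k) \<le> c j" if k: "k \<in> {1..j}" for k
  proof -
    have "p (\<pi> k) \<le> p (\<pi> j)"
      using ord k js by (auto simp: orders_pvalues_def)
    also have "\<dots> \<le> c j"
      using js jR by (intro stepdown_count_props) auto
    finally show ?thesis .
  qed
  then have "\<pi> ` {1..j} \<subseteq> {i \<in> ?A. p i \<le> c j} \<union> {i \<in> I. p i \<le> c j}"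
    using card_stepdown_prefix(2)[OF ord, of j] js by auto
  then have "card (\<pi> ` {1..j}) \<le> card ({i \<in> ?A. p i \<le> c j} \<union> {i \<in> I. p i \<le> c j})"
    using finI by (intro card_mono) auto
  also have "\<dots> \<le> card {i \<in> ?A. p i \<le> c j} + card {i \<in> I. p i \<le> c j}"
    by (rule card_Un_le)
  finally have "j \<le> card {i \<in> ?A. p i \<le> c j} + card {i \<in> I. p i \<le> c j}"
    using card_stepdown_prefix(1)[OF ord, of j] js by simp
  moreover have "critical_count \<gamma> j \<le> j"
    using \<gamma> js by (intro critical_count_le) auto
  ultimately have "critical_count \<gamma> j \<le> card {i \<in> I. p i \<le> c j}"
    using few by linarith
  then show ?thesis
    using pivot js by blast
qed

lemma sets_pivot_step:
  assumes "finite A" "\<And>i. i \<in> A \<Longrightarrow> p i \<in> borel_measurable N"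
  shows "{x \<in> space N. pivot_step \<gamma> c A (\<lambda>i. p i x) j} \<in> sets N"
proof -
  have [measurable]: "(\<lambda>x. real (card {i \<in> A. p i x \<le> t})) \<in> borel_measurable N" for t
    using assms by (rule borel_measurable_real_card_le)
  have "{x \<in> space N. pivot_step \<gamma> c A (\<lambda>i. p i x) j} =
    {x \<in> space N. real (card {i \<in> A. p i x \<le> c j}) \<le> real (j - critical_count \<gamma> j) \<and>
      (\<forall>l\<in>{1..<j}. real (l - critical_count \<gamma> l) < real (card {i \<in> A. p i x \<le> c l}))}"
    by (simp add: pivot_step_def)
  also have "\<dots> \<in> sets N"
    by measurable
  finally show ?thesis .
qed

section \<open>Control of the false discovery proportion\<close>

theorem theorem3p1:
  fixes M :: "'x measure"
    and \<Omega> :: "'x measure set"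
    and \<omega> :: "nat \<Rightarrow> 'x measure set"
    and P :: "'x measure"
    and s :: nat
    and p :: "nat \<Rightarrow> 'x \<Rightarrow> real"
    and \<pi> :: "'x \<Rightarrow> nat \<Rightarrow> nat"
    and \<gamma> \<alpha> :: real
  assumes model: "\<Omega> \<subseteq> space (prob_algebra M)"
    and hypotheses: "\<And>i. i \<in> {1..s} \<Longrightarrow> \<omega> i \<subseteq> \<Omega>"
    and true_law: "P \<in> \<Omega>"
    and gamma: "0 < \<gamma>" "\<gamma> < 1"
    and alpha: "0 < \<alpha>" "\<alpha> < 1"
    and pvalue_measurable: "\<And>i. i \<in> {1..s} \<Longrightarrow> p i \<in> borel_measurable M"
    and pvalue_range: "\<And>i x. i \<in> {1..s} \<Longrightarrow> x \<in> space M \<Longrightarrow> p i x \<in> {0..1}"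
    and ordering: "\<And>x. x \<in> space M \<Longrightarrow> orders_pvalues s (\<lambda>i. p i x) (\<pi> x)"
    and conditional: "\<And>i u. i \<in> true_nulls s \<omega> P \<Longrightarrow> 0 < u \<Longrightarrow> u < 1 \<Longrightarrow>
      AE x in P. cond_prob_given P (sigma_generated P ({1..s} - true_nulls s \<omega> P) p)
                   {y \<in> space P. p i y \<le> u} x \<le> u"
  shows "measure P {x \<in> space P.
           FDP (true_nulls s \<omega> P)
             (stepdown_rejections s (fdp_constant \<gamma> \<alpha> s) (\<lambda>i. p i x) (\<pi> x)) > \<gamma>} \<le> \<alpha>"
proof -
  have "P \<in> space (prob_algebra M)"
    using model true_law by blast
  then have sets_eq: "sets P = sets M" and "prob_space P"
    by (auto simp: space_prob_algebra)
  then interpret prob_space P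
    by simp
  have space_eq: "space P = space M"
    using sets_eq by (rule sets_eq_imp_space_eq)
  define I where "I = true_nulls s \<omega> P"
  define A where "A = {1..s} - I"
  define F where "F = sigma_generated P A p"
  define c where "c = fdp_constant \<gamma> \<alpha> s"
  define m where "m = critical_count \<gamma>"
  have I: "I \<subseteq> {1..s}" "finite I" and finA: "finite A"
    by (auto simp: I_def A_def true_nulls_def)
  have meas: "p i \<in> borel_measurable P" if "i \<in> {1..s}" for i
    using pvalue_measurable[OF that] sets_eq by (simp cong: measurable_cong_sets)
  have subalg: "subalgebra P F"
    unfolding F_def using meas by (intro subalgebra_sigma_generated) (auto simp: A_def)
  have c_mono: "c i \<le> c j" if "i \<le> j" "j \<le> s" for i j
    using that gamma alpha by (simp add: c_def fdp_constant_mono)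
  define D where "D j = {x \<in> space P. pivot_step \<gamma> c A (\<lambda>i. p i x) j}" for j
  define B where "B j = {x \<in> D j. m j \<le> card {i \<in> I. p i x \<le> c j}}" for j
  have DF: "D j \<in> sets F" for j
  proof -
    have "{x \<in> space F. pivot_step \<gamma> c A (\<lambda>i. p i x) j} \<in> sets F"
      unfolding F_def by (intro sets_pivot_step finA measurable_sigma_generated)
    then show ?thesis
      using subalg by (simp add: D_def subalgebra_def)
  qed
  then have DP: "D j \<in> sets P" for j
    using subalg by (auto simp: subalgebra_def)
  have BP: "B j \<in> sets P" for j
  proof -
    have "(\<lambda>x. real (card {i \<in> I. p i x \<le> c j})) \<in> borel_measurable P"
      using I meas by (intro borel_measurable_real_card_le) auto
    then have "{x \<in> space P. real (m j) \<le> real (card {i \<in> I. p i x \<le> c j})} \<in> sets P"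
      by (intro borel_measurable_le) auto
    moreover have
      "B j = D j \<inter> {x \<in> space P. real (m j) \<le> real (card {i \<in> I. p i x \<le> c j})}"
      by (auto simp: B_def D_def)
    ultimately show ?thesis
      using DP by simp
  qed
  have B_le: "prob (B j) \<le> \<alpha> * prob (D j)" if j: "j \<in> {1..s}" for j
  proof (cases "D j = {}")
    case True
    then show ?thesis
      by (simp add: B_def)
  next
    case False
    \<comment> \<open>One sample point at which \<open>j\<close> is the pivot suffices to bound the number of true nulls,
      which is not random.\<close>
    then obtain x where x: "pivot_step \<gamma> c A (\<lambda>i. p i x) j"
      by (auto simp: D_def)
    have cj: "0 < c j" "c j < 1"
      using j gamma alpha by (auto simp: c_def intro!: fdp_constant_bounds)
    have mpos: "0 < m j"
      by (simp add: m_def critical_count_def)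
    have "real (m j) * prob (B j) \<le> (\<Sum>i\<in>I. prob (D j \<inter> {x \<in> space P. p i x \<le> c j}))"
      unfolding B_def using I meas by (intro measure_card_le_sum_measure DP) auto
    also have "\<dots> \<le> (\<Sum>i\<in>I. c j * prob (D j))"
    proof (rule sum_mono)
      fix i assume i: "i \<in> I"
      have "{x \<in> space P. p i x \<le> c j} \<in> sets P"
        using meas[of i] i I by (intro borel_measurable_le) auto
      moreover have "AE x in P. cond_prob_given P F {y \<in> space P. p i y \<le> c j} x \<le> c j"
        using conditional[of i "c j"] i cj by (simp add: F_def A_def I_def)
      ultimately show "prob (D j \<inter> {x \<in> space P. p i x \<le> c j}) \<le> c j * prob (D j)"
        by (intro prob_Int_le_if_cond_prob_given_le[OF subalg DF])
    qed
    also have "\<dots> = (real (card I) * c j) * prob (D j)"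
      by simp
    also have "\<dots> \<le> (\<alpha> * real (m j)) * prob (D j)"
      unfolding m_def c_def
      by (intro mult_right_mono fdp_constant_pivot_le[OF gamma alpha(1) I(1) j x[unfolded A_def]])
        simp
    finally have "real (m j) * prob (B j) \<le> real (m j) * (\<alpha> * prob (D j))"
      by (simp add: mult_ac)
    then show ?thesis
      using mpos by (simp only: mult_le_cancel_left_pos of_nat_0_less_iff)
  qed
  have disj: "disjoint_family_on D {1..s}"
    unfolding disjoint_family_on_def D_def using pivot_step_unique by fastforce
  have "{x \<in> space P. FDP I (stepdown_rejections s c (\<lambda>i. p i x) (\<pi> x)) > \<gamma>}
      \<subseteq> (\<Union>j\<in>{1..s}. B j)"
  proof clarify
    fix x assume x: "x \<in> space P"
      and "\<gamma> < FDP I (stepdown_rejections s c (\<lambda>i. p i x) (\<pi> x))"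
    then have "\<exists>j\<in>{1..s}. pivot_step \<gamma> c A (\<lambda>i. p i x) j \<and>
        m j \<le> card {i \<in> I. p i x \<le> c j}"
      unfolding A_def m_def
      using fdp_exceedance_pivot[OF gamma I(1) ordering c_mono] by (simp add: space_eq)
    then show "x \<in> (\<Union>j\<in>{1..s}. B j)"
      using x by (auto simp: B_def D_def)
  qed
  then have "prob {x \<in> space P. FDP I (stepdown_rejections s c (\<lambda>i. p i x) (\<pi> x)) > \<gamma>}
      \<le> prob (\<Union>j\<in>{1..s}. B j)"
    using BP by (intro finite_measure_mono) auto
  also have "\<dots> \<le> (\<Sum>j\<in>{1..s}. prob (B j))"
    using BP by (intro finite_measure_subadditive_finite) auto
  also have "\<dots> \<le> (\<Sum>j\<in>{1..s}. \<alpha> * prob (D j))"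
    using B_le by (rule sum_mono)
  also have "\<dots> = \<alpha> * prob (\<Union>j\<in>{1..s}. D j)"
    using DP disj by (subst finite_measure_finite_Union) (auto simp: sum_distrib_left)
  also have "\<dots> \<le> \<alpha>"
    using alpha by (simp add: mult_left_le)
  finally show ?thesis
    by (simp add: I_def c_def)
qed

end
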